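(* Let $k,n\ge1$ be integers and let $\mu$ be a $k$-Dyck path from $(0,0)$ to $(kn,n)$. Then $$\sum_{D\in\mathcal{D}^{(k)}( */\mu)} q^{\mathrm{tiles}(D)} = \prod_{u\in \mathrm{UP}(\mu)} [\mathrm{ht}(u)]_q .$$
   Context: A $k$-Dyck path is a lattice path of up steps $(0,1)$ and down steps $(1,0)$ from $(0,0)$ to $(kn,n)$ (for some $n\ge0$) which never goes below the line $y=x/k$. Cells are unit squares with integer corners. A $k$-Dyck tile is a ribbon (finite set of cells) such that the centers of its cells are the lattice points of a translate of a $k$-Dyck path (the path of length $0$ is allowed, giving a single cell). For $k$-Dyck paths $\lambda,\mu$ from $(0,0)$ to $(kn,n)$ with $\mu$ weakly above $\lambda$, a (cover-inclusive) $k$-Dyck tiling of $\lambda/\mu$ is a tiling $D$ by $k$-Dyck tiles of the region between $\lambda$ and $\mu$ such that if $\eta$ is a tile of $D$, then the translate of $\eta$ by $(1,-1)$ is either completely below $\lambda$ or contained in another tile of $D$. $\mathcal{D}^{(k)}( */\mu)$ is the set of $k$-Dyck tilings with fixed upper path $\mu$ (and arbitrary lower path $\lambda$), and $\mathrm{tiles}(D)$ is the number of tiles of $D$. $\mathrm{UP}(\mu)$ is the set of up steps of $\mu$. For an up step $u$, the height $\mathrm{ht}(u)$ is $1$ plus the number of squares (cells lying in the same row as $u$, to the right of $u$ and entirely above the line) between $u$ and the line $y=x/k$; so if $u$ starts at $(a,b)$ then $\mathrm{ht}(u)=kb-a+1$. Finally $[m]_q=1+q+\cdots+q^{m-1}$.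 *)

theory Defs
  imports Main
begin

datatype step = Up | Down

type_synonym path = "step list"

text \<open>All paths start at the origin; \<open>point p i\<close> is the lattice point reached after \<open>i\<close> steps.\<close>

definition point :: "path \<Rightarrow> nat \<Rightarrow> int \<times> int" where
  "point p i = (int (count_list (take i p) Down), int (count_list (take i p) Up))"

definition points :: "path \<Rightarrow> (int \<times> int) set" where
  "points p = point p ` {..length p}"

definition weakly_above_line :: "nat \<Rightarrow> int \<times> int \<Rightarrow> bool" where
  "weakly_above_line k = (\<lambda>(x, y). x \<le> int k * y)"

definition dyck_path :: "nat \<Rightarrow> nat \<Rightarrow> path \<Rightarrow> bool" where
  "dyck_path k n p \<longleftrightarrow>
     point p (length p) = (int (k * n), int n) \<and> (\<forall>P\<in>points p. weakly_above_line k P)"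

text \<open>For two paths of the same length, the points after \<open>i\<close> steps lie on a common
  antidiagonal, so being weakly above can be tested on their second coordinates.\<close>

definition path_weakly_above :: "path \<Rightarrow> path \<Rightarrow> bool" where
  "path_weakly_above \<mu> lam \<longleftrightarrow>
     length \<mu> = length lam \<and> (\<forall>i\<le>length \<mu>. snd (point lam i) \<le> snd (point \<mu> i))"

text \<open>An up step is identified with its starting point.\<close>

definition up_steps :: "path \<Rightarrow> (int \<times> int) set" where
  "up_steps p = {point p i | i. i < length p \<and> p ! i = Up}"

text \<open>A cell is identified with its lower left corner, so \<open>(x, y)\<close> is the
  unit square \<open>[x, x + 1] \<times> [y, y + 1]\<close>.\<close>

type_synonym cell = "int \<times> int"

definition cell_above_line :: "nat \<Rightarrow> cell \<Rightarrow> bool" where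
  "cell_above_line k = (\<lambda>(x, y). \<forall>P\<in>{x, x + 1} \<times> {y, y + 1}. weakly_above_line k P)"

definition height :: "nat \<Rightarrow> int \<times> int \<Rightarrow> nat" where
  "height k = (\<lambda>(a, b). 1 + card {(x, y). y = b \<and> a \<le> x \<and> cell_above_line k (x, y)})"

lemma height_eq:
  assumes "a \<le> int k * b"
  shows "int (height k (a, b)) = int k * b - a + 1"
proof -
  have "b * int k \<le> int k * (b + 1)"
    by (simp add: algebra_simps)
  then have "{(x, y). y = b \<and> a \<le> x \<and> cell_above_line k (x, y)} = {a..<int k * b} \<times> {b}"
    by (auto simp: cell_above_line_def weakly_above_line_def algebra_simps)
  then show ?thesis
    using assms by (simp add: height_def card_cartesian_product)
qed

text \<open>A cell lies below (above) a path if it is to the right (left) of the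
  up step of the path in the row of the cell.\<close>

definition cell_below_path :: "path \<Rightarrow> cell \<Rightarrow> bool" where
  "cell_below_path p = (\<lambda>(x, y). \<exists>a. (a, y) \<in> up_steps p \<and> a \<le> x)"

definition cell_above_path :: "path \<Rightarrow> cell \<Rightarrow> bool" where
  "cell_above_path p = (\<lambda>(x, y). \<exists>a. (a, y) \<in> up_steps p \<and> x < a)"

definition region :: "path \<Rightarrow> path \<Rightarrow> cell set" where
  "region lam \<mu> = {c. cell_below_path \<mu> c \<and> cell_above_path lam c}"

definition translate :: "int \<times> int \<Rightarrow> cell set \<Rightarrow> cell set" where
  "translate = (\<lambda>(a, b) S. (\<lambda>(x, y). (a + x, b + y)) ` S)"

text \<open>Centers and lower left corners of cells differ by the fixed vector \<open>(1/2, 1/2)\<close>,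
  so the translates of the set of lattice points of a path by that vector plus an integer
  vector correspond to the integer translates of the set of its points, read as cells.\<close>

definition dyck_tile :: "nat \<Rightarrow> cell set \<Rightarrow> bool" where
  "dyck_tile k t \<longleftrightarrow> (\<exists>m p v. dyck_path k m p \<and> t = translate v (points p))"

definition cover_inclusive :: "path \<Rightarrow> cell set set \<Rightarrow> bool" where
  "cover_inclusive lam D \<longleftrightarrow>
     (\<forall>t\<in>D. (\<forall>c\<in>translate (1, - 1) t. cell_below_path lam c) \<or>
            (\<exists>t'\<in>D. t' \<noteq> t \<and> translate (1, - 1) t \<subseteq> t'))"

definition dyck_tiling :: "nat \<Rightarrow> path \<Rightarrow> path \<Rightarrow> cell set set \<Rightarrow> bool" where
  "dyck_tiling k lam \<mu> D \<longleftrightarrow>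
     (\<forall>t\<in>D. dyck_tile k t) \<and> pairwise disjnt D \<and> \<Union>D = region lam \<mu> \<and> cover_inclusive lam D"

text \<open>The lower path need not be recorded, as it is determined by \<open>\<mu>\<close> and the
  region covered by the tiles.\<close>

definition dyck_tilings :: "nat \<Rightarrow> nat \<Rightarrow> path \<Rightarrow> cell set set set" where
  "dyck_tilings k n \<mu> =
     {D. \<exists>lam. dyck_path k n lam \<and> path_weakly_above \<mu> lam \<and> dyck_tiling k lam \<mu> D}"

abbreviation tiles :: "cell set set \<Rightarrow> nat" where
  "tiles D \<equiv> card D"

definition q_bracket :: "nat \<Rightarrow> 'a::comm_semiring_1 \<Rightarrow> 'a" where
  "q_bracket m q = (\<Sum>i<m. q ^ i)"

lemma finite_dyck_tilings: "finite (dyck_tilings k n \<mu>)"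
proof -
  have up: "fst c \<in> {0..int (k * n)} \<and> snd c \<in> {0..int n}"
    if "dyck_path k n p" "c \<in> up_steps p" for p c
  proof -
    have le: "count_list (take i p) s \<le> count_list p s" for i s
      by (metis append_take_drop_id count_list_append le_add1)
    have "count_list p Down = k * n" "count_list p Up = n"
      using that(1) by (auto simp: dyck_path_def point_def simp flip: of_nat_mult)
    then show ?thesis
      using that(2) le[of _ Down] le[of _ Up]
      by (auto simp: up_steps_def point_def simp flip: of_nat_mult)
  qed
  have pos: "0 \<le> fst c" if "c \<in> up_steps p" for p c
    using that by (auto simp: up_steps_def point_def)
  have "region lam \<mu> \<subseteq> {0..int (k * n)} \<times> {0..int n}" if "dyck_path k n lam" for lam
    using up[OF that] pos[of _ \<mu>]
    by (fastforce simp: region_def cell_below_path_def cell_above_path_def)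
  then have "dyck_tilings k n \<mu> \<subseteq> Pow (Pow ({0..int (k * n)} \<times> {0..int n}))"
    unfolding dyck_tilings_def dyck_tiling_def by blast
  then show ?thesis
    by (rule finite_subset) simp
qed

end

theory Submission
  imports Defs
begin

text \<open>
  The proof removes the top row. Write the upper path as \<open>\<mu> = p U D\<^sup>j\<close>, where \<open>U\<close> is its last up
  step, which has height \<open>j - k + 1\<close>, and put \<open>\<mu>' = p D\<^sup>j\<^sup>-\<^sup>k\<close>. It suffices to find a bijection between
  the tilings \<open>D\<close> under \<open>\<mu>\<close> and the pairs \<open>(h, D')\<close> of a number \<open>0 \<le> h \<le> j - k\<close> and a tiling
  \<open>D'\<close> under \<open>\<mu>'\<close> such that \<open>D\<close> has \<open>h\<close> tiles more than \<open>D'\<close>; the product formula follows by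
  induction on the number of up steps.

  From \<open>(h, D')\<close> one obtains \<open>D\<close> by inserting \<open>U D\<^sup>k\<close> on the antidiagonal \<open>x + y = s\<close>, where \<open>s\<close> is
  the length of \<open>p\<close> plus \<open>h\<close>. Every path and every tile that meets this antidiagonal is cut open there
  and receives an additional up step followed by \<open>k\<close> down steps; everything beyond it moves by
  \<open>(k, 1)\<close>. Then the first \<open>h\<close> cells of the top row are still free, and they become
  tiles consisting of one cell.

  On cells this insertion is the preimage under one surjective map of the plane,
  \<open>collapse\<close>, which commutes with the translation by \<open>(1, -1)\<close>. Therefore disjointness, unions,
  differences and cover-inclusiveness are transported in both directions without any work. What has to be
  checked is that preimages of tiles and of the cells below a path are what they should be
  (\<open>expand_tile_at\<close>, \<open>expand_below\<close>).

  Conversely, \<open>h\<close> is recovered from \<open>D\<close> as the length of the initial run of one-cell tiles in the top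
  row. The next cell of that row lies in a tile that rises into the row exactly there, and
  a \<open>k\<close>-Dyck path that reaches its final height has at least \<open>k\<close> down steps left
  (\<open>top_tile_crosses\<close>). So this tile contains \<open>U D\<^sup>k\<close> on the antidiagonal \<open>x + y = s\<close>, and
  cover-inclusiveness passes this property on to each region cell further down the antidiagonal,
  and finally to the lower path. Hence \<open>U D\<^sup>k\<close> can be deleted everywhere (\<open>grow_surj\<close>).
\<close>

section \<open>Lattice paths through their partial numbers of up steps\<close>

text \<open>A path is handled through this function alone; beyond the end of the path it stays constant,
  which spares the range conditions on the index.\<close>

definition ups :: "path \<Rightarrow> nat \<Rightarrow> nat" where
  "ups p i = count_list (take i p) Up"

lemma count_Down_Up: "count_list p Down + count_list p Up = length p"
proof (induction p)
  case (Cons s p)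
  then show ?case by (cases s) auto
qed simp

lemma point_ups:
  assumes "i \<le> length p"
  shows "point p i = (int i - int (ups p i), int (ups p i))"
  using count_Down_Up[of "take i p"] assms by (auto simp: point_def ups_def)

lemma ups_0 [simp]: "ups p 0 = 0"
  by (simp add: ups_def)

lemma ups_Suc:
  "ups p (Suc i) = ups p i + (if i < length p \<and> p ! i = Up then 1 else 0)"
  by (cases "i < length p") (auto simp: ups_def take_Suc_conv_app_nth not_less)

lemma ups_mono: "i \<le> i' \<Longrightarrow> ups p i \<le> ups p i'"
  by (rule lift_Suc_mono_le[of "ups p"]) (auto simp: ups_Suc)

lemma ups_ge_length: "length p \<le> i \<Longrightarrow> ups p i = ups p (length p)"
  by (simp add: ups_def)

lemma ups_le_total: "ups p i \<le> ups p (length p)"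
  by (metis ups_mono ups_ge_length nat_le_linear)

text \<open>The maximum merges two cases: after the new up step the count stays constant during the inserted
  down steps, and then resumes as in the old path \<open>k + 1\<close> steps earlier.\<close>

lemma ups_insert:
  "ups (p1 @ Up # replicate k Down @ p2) i =
     (if i \<le> length p1 then ups (p1 @ p2) i
      else Suc (ups (p1 @ p2) (max (length p1) (i - Suc k))))"
proof -
  have D: "count_list (replicate m Down) Up = 0" for m
    by (induction m) auto
  show ?thesis
  proof (cases "i \<le> length p1")
    case False
    then obtain d where i: "i = length p1 + Suc d"
      by (metis add_Suc_right less_imp_Suc_add not_le)
    show ?thesis
    proof (cases "d \<le> k")
      case True
      then have "max (length p1) (i - Suc k) = length p1" by (simp add: i)
      with True show ?thesis by (simp add: ups_def i D)
    next
      case False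
      then have "max (length p1) (i - Suc k) = length p1 + (d - k)" by (simp add: i)
      with False show ?thesis by (simp add: ups_def i D)
    qed
  qed (simp add: ups_def)
qed

text \<open>Three values of the counting function suffice to recognise a factor \<open>U D\<^sup>k\<close>, since the
  function is monotone.\<close>

lemma split_at_up_downs:
  assumes "m + Suc k \<le> length p" and "ups p m < ups p (Suc m)"
    and "ups p (m + Suc k) \<le> ups p (Suc m)"
  obtains p1 p2 where "p = p1 @ Up # replicate k Down @ p2" and "length p1 = m"
proof -
  have up: "p ! m = Up" using assms(2) by (auto simp: ups_Suc split: if_splits)
  have down: "p ! (Suc m + r) = Down" if "r < k" for r
  proof (rule ccontr)
    assume "p ! (Suc m + r) \<noteq> Down"
    then have "p ! (Suc m + r) = Up" by (cases "p ! (Suc m + r)") auto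
    then have "ups p (Suc m + r) < ups p (Suc (Suc m + r))"
      using that assms(1) by (simp add: ups_Suc[of p "Suc (m + r)"])
    moreover have "ups p (Suc m) \<le> ups p (Suc m + r)" by (intro ups_mono) simp
    moreover have "ups p (Suc (Suc m + r)) \<le> ups p (m + Suc k)"
      using that by (intro ups_mono) simp
    ultimately show False using assms(3) by simp
  qed
  have mid: "take k (drop (Suc m) p) = replicate k Down"
    using assms(1) down by (intro nth_equalityI) auto
  have "p = take m p @ drop m p" by simp
  also have "drop m p = Up # drop (Suc m) p"
    using assms(1) up Cons_nth_drop_Suc[of m p] by simp
  also have "drop (Suc m) p = replicate k Down @ drop k (drop (Suc m) p)"
    by (metis mid append_take_drop_id)
  finally show ?thesis using that[of "take m p"] assms(1) by simp
qed

lemma dyck_path_ups: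
  "dyck_path k n p \<longleftrightarrow>
     length p = Suc k * n \<and> ups p (length p) = n \<and> (\<forall>i\<le>length p. i \<le> Suc k * ups p i)"
proof -
  have 1: "(\<forall>P\<in>points p. weakly_above_line k P) \<longleftrightarrow> (\<forall>i\<le>length p. i \<le> Suc k * ups p i)"
  proof -
    have "weakly_above_line k (point p i) \<longleftrightarrow> i \<le> Suc k * ups p i" if "i \<le> length p" for i
    proof -
      have "weakly_above_line k (point p i) \<longleftrightarrow> int i \<le> int (Suc k * ups p i)"
        using that by (simp add: point_ups weakly_above_line_def algebra_simps)
      then show ?thesis by linarith
    qed
    then show ?thesis by (auto simp: points_def)
  qed
  have 2: "point p (length p) = (int (k * n), int n) \<longleftrightarrow>
      length p = Suc k * n \<and> ups p (length p) = n"
  proof -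
    have "point p (length p) = (int (k * n), int n) \<longleftrightarrow>
       int (length p) = int (k * n) + int n \<and> ups p (length p) = n"
      by (auto simp: point_ups)
    also have "int (k * n) + int n = int (Suc k * n)" by simp
    finally show ?thesis by (simp only: of_nat_eq_iff)
  qed
  show ?thesis unfolding dyck_path_def 1 2 by blast
qed

text \<open>Inserting \<open>U D\<^sup>k\<close> moves the rest of the path by \<open>(k, 1)\<close>, a vector parallel to the line
  \<open>y = x / k\<close>, and the new points lie no further to the right of that line than the
  point of insertion.\<close>

lemma dyck_path_insert:
  "dyck_path k (Suc n) (p1 @ Up # replicate k Down @ p2) \<longleftrightarrow> dyck_path k n (p1 @ p2)"
    (is "dyck_path _ _ ?q \<longleftrightarrow> dyck_path _ _ ?p")
proof -
  have total: "ups ?q (length ?q) = Suc (ups ?p (length ?p))"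
    by (simp add: ups_insert)
  have "(\<forall>i\<le>length ?q. i \<le> Suc k * ups ?q i) \<longleftrightarrow> (\<forall>i\<le>length ?p. i \<le> Suc k * ups ?p i)"
  proof (intro iffI allI impI)
    fix i assume q: "\<forall>i\<le>length ?q. i \<le> Suc k * ups ?q i" and i: "i \<le> length ?p"
    show "i \<le> Suc k * ups ?p i"
    proof (cases "i \<le> length p1")
      case True
      then show ?thesis using q[rule_format, of i] i by (simp add: ups_insert)
    next
      case False
      then show ?thesis using q[rule_format, of "i + Suc k"] i by (simp add: ups_insert)
    qed
  next
    fix i assume p: "\<forall>i\<le>length ?p. i \<le> Suc k * ups ?p i" and i: "i \<le> length ?q"
    show "i \<le> Suc k * ups ?q i"
    proof (cases "i \<le> length p1")
      case True
      then show ?thesis using p[rule_format, of i] by (simp add: ups_insert)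
    next
      case False
      define j where "j = max (length p1) (i - Suc k)"
      have "j \<le> Suc k * ups ?p j" using i by (intro p[rule_format]) (auto simp: j_def)
      moreover have "i \<le> j + Suc k" by (simp add: j_def)
      moreover have "ups ?q i = Suc (ups ?p j)" using False by (simp add: ups_insert j_def)
      ultimately show ?thesis by simp
    qed
  qed
  moreover have "length ?q = Suc k * Suc n \<longleftrightarrow> length ?p = Suc k * n"
    by simp
  ultimately show ?thesis unfolding dyck_path_ups total by simp
qed

section \<open>Regions and cover-inclusive tilings in terms of antidiagonals\<close>

text \<open>The upper left corner \<open>(x, y + 1)\<close> of a cell is compared with the point of the path on the
  same antidiagonal. Unlike \<^const>\<open>cell_below_path\<close>, this does not confine the cell to the rows that the
  path crosses; without such boundaries the set is compatible with the insertion of steps.\<close>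

definition below :: "path \<Rightarrow> cell set" where
  "below p = {(x, y). y + 1 \<le> int (ups p (nat (x + y + 1)))}"

lemma mem_below: "(x, y) \<in> below p \<longleftrightarrow> y + 1 \<le> int (ups p (nat (x + y + 1)))"
  by (simp add: below_def)

lemma up_step_in_row:
  assumes "0 \<le> y" and "y < int (ups p (length p))"
  obtains a where "(a, y) \<in> up_steps p"
proof -
  obtain i where i: "i < length p" "ups p i \<le> nat y" "nat y < ups p (Suc i)"
  proof -
    define i where "i = (LEAST i. nat y < ups p i)"
    have ex: "nat y < ups p (length p)" using assms by linarith
    then have le: "i \<le> length p" unfolding i_def by (rule Least_le)
    have gt: "nat y < ups p i" unfolding i_def using ex by (rule LeastI)
    then obtain i' where i': "i = Suc i'" by (cases i) auto
    then have "\<not> nat y < ups p i'" using not_less_Least[of i' "\<lambda>i. nat y < ups p i"] by (simp flip: i_def)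
    then show ?thesis using that[of i'] le gt i' by simp
  qed
  then have "p ! i = Up" "ups p i = nat y" by (auto simp: ups_Suc split: if_splits)
  then have "(int i - y, y) \<in> up_steps p"
    using i assms by (auto simp: up_steps_def point_ups intro!: exI[of _ i])
  then show ?thesis by (rule that)
qed

text \<open>This links the row-wise comparison of cells and paths to the one along antidiagonals.\<close>

lemma up_step_left_iff:
  assumes "(a, y) \<in> up_steps p"
  shows "a \<le> x \<longleftrightarrow> (x, y) \<in> below p" and "0 \<le> y" and "y < int (ups p (length p))"
proof -
  obtain i where i: "i < length p" "p ! i = Up" "point p i = (a, y)"
    using assms by (auto simp: up_steps_def)
  then have y: "int (ups p i) = y" and a: "a = int i - y" by (auto simp: point_ups)
  have S: "ups p (Suc i) = Suc (ups p i)" using i by (simp add: ups_Suc)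
  show "0 \<le> y" using y by simp
  show "y < int (ups p (length p))" using ups_le_total[of p "Suc i"] S y by simp
  show "a \<le> x \<longleftrightarrow> (x, y) \<in> below p"
  proof
    assume "a \<le> x"
    then have "Suc i \<le> nat (x + y + 1)" using a by simp
    from ups_mono[OF this, of p] show "(x, y) \<in> below p" using S y by (simp add: mem_below)
  next
    assume b: "(x, y) \<in> below p"
    show "a \<le> x"
    proof (rule ccontr)
      assume "\<not> a \<le> x"
      then have "nat (x + y + 1) \<le> i" using a by simp
      from ups_mono[OF this, of p] show False using b y by (simp add: mem_below)
    qed
  qed
qed

lemma cell_below_path_iff: "cell_below_path p (x, y) \<longleftrightarrow> 0 \<le> y \<and> (x, y) \<in> below p"
proof
  assume "cell_below_path p (x, y)"
  then show "0 \<le> y \<and> (x, y) \<in> below p"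
    using up_step_left_iff by (auto simp: cell_below_path_def)
next
  assume *: "0 \<le> y \<and> (x, y) \<in> below p"
  then have "y < int (ups p (length p))"
    using ups_le_total[of p "nat (x + y + 1)"] by (auto simp: mem_below)
  with * obtain a where "(a, y) \<in> up_steps p" using up_step_in_row by blast
  then show "cell_below_path p (x, y)"
    using * up_step_left_iff by (auto simp: cell_below_path_def)
qed

lemma cell_above_path_iff:
  "cell_above_path p (x, y) \<longleftrightarrow>
     0 \<le> y \<and> y < int (ups p (length p)) \<and> (x, y) \<notin> below p"
proof
  assume "cell_above_path p (x, y)"
  then obtain a where a: "(a, y) \<in> up_steps p" "x < a" by (auto simp: cell_above_path_def)
  then show "0 \<le> y \<and> y < int (ups p (length p)) \<and> (x, y) \<notin> below p"
    using up_step_left_iff(1)[OF a(1), of x] up_step_left_iff(2,3)[OF a(1)] by simp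
next
  assume *: "0 \<le> y \<and> y < int (ups p (length p)) \<and> (x, y) \<notin> below p"
  then obtain a where a: "(a, y) \<in> up_steps p" using up_step_in_row by blast
  then have "x < a" using * up_step_left_iff(1)[OF a, of x] by auto
  with a show "cell_above_path p (x, y)" by (auto simp: cell_above_path_def)
qed

lemma below_right:
  assumes "(x, y) \<in> below p" and "x \<le> x'"
  shows "(x', y) \<in> below p"
proof -
  have "nat (x + y + 1) \<le> nat (x' + y + 1)" using assms(2) by simp
  from ups_mono[OF this, of p] show ?thesis using assms(1) by (simp add: mem_below)
qed

lemma below_diagonal: "(x, y) \<in> below p \<Longrightarrow> (x + 1, y - 1) \<in> below p"
  by (simp add: mem_below)

lemma below_down:
  assumes "(x, y + 1) \<in> below p"
  shows "(x, y) \<in> below p"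
proof (cases "x + y + 1 < 0")
  case False
  then have "nat (x + (y + 1) + 1) = Suc (nat (x + y + 1))" by simp
  then show ?thesis using assms by (simp add: mem_below ups_Suc split: if_splits)
qed (use assms in \<open>simp add: mem_below\<close>)

lemma region_below:
  assumes "dyck_path k n lam" and "dyck_path k n \<mu>"
  shows "region lam \<mu> = below \<mu> - below lam"
proof (rule set_eqI)
  fix c :: cell
  obtain x y where c: "c = (x, y)" by (cases c)
  have tot: "ups lam (length lam) = n" "ups \<mu> (length \<mu>) = n"
    using assms by (auto simp: dyck_path_ups)
  show "c \<in> region lam \<mu> \<longleftrightarrow> c \<in> below \<mu> - below lam"
    using ups_le_total[of \<mu> "nat (x + y + 1)"] tot
    unfolding region_def
    by (auto simp: c cell_below_path_iff cell_above_path_iff mem_below)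
qed

text \<open>A nonempty path that never goes below the line starts with an up step, so it leaves no room in row
  zero. Hence the translate of a region cell by \<open>(1, -1)\<close> still has a nonnegative row, where the two
  notions of being below a path agree.\<close>

lemma region_row_positive:
  assumes "dyck_path k n lam" and "dyck_path k n \<mu>" and "(x, y) \<in> below \<mu> - below lam"
  shows "0 < y"
proof (rule ccontr)
  assume "\<not> 0 < y"
  define l where "l = nat (x + y + 1)"
  have \<mu>: "y + 1 \<le> int (ups \<mu> l)" and lam: "int (ups lam l) < y + 1"
    using assms(3) by (auto simp: mem_below l_def)
  then have 0: "ups lam l = 0" "0 < ups \<mu> l" using \<open>\<not> 0 < y\<close> by linarith+
  then have l: "0 < l" by (cases l) auto
  have n: "0 < n"
    using 0 ups_le_total[of \<mu> l] assms(2) by (auto simp: dyck_path_ups)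
  then have "ups lam l \<noteq> 0"
  proof (cases "l \<le> length lam")
    case True
    then have "l \<le> Suc k * ups lam l" using assms(1) by (auto simp: dyck_path_ups)
    then show ?thesis using l by (cases "ups lam l") auto
  next
    case False
    then show ?thesis using ups_ge_length[of lam l] n assms(1) by (auto simp: dyck_path_ups)
  qed
  then show False using 0 by simp
qed

lemma mem_translate: "(x, y) \<in> translate (a, b) S \<longleftrightarrow> (x - a, y - b) \<in> S"
  by (force simp: translate_def)

lemma dyck_tiling_iff:
  assumes "dyck_path k n lam" and "dyck_path k n \<mu>"
  shows "dyck_tiling k lam \<mu> D \<longleftrightarrow>
    (\<forall>t\<in>D. dyck_tile k t) \<and> pairwise disjnt D \<and> \<Union>D = below \<mu> - below lam \<and>
    (\<forall>t\<in>D. translate (1, - 1) t \<subseteq> below lam \<or>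
           (\<exists>t'\<in>D. t' \<noteq> t \<and> translate (1, - 1) t \<subseteq> t'))"
proof -
  have iff: "(\<forall>c\<in>translate (1, - 1) t. cell_below_path lam c) \<longleftrightarrow>
      translate (1, - 1) t \<subseteq> below lam"
    if "\<Union>D = below \<mu> - below lam" "t \<in> D" for t
  proof -
    have "cell_below_path lam c \<longleftrightarrow> c \<in> below lam" if c: "c \<in> translate (1, - 1) t" for c
    proof -
      obtain x y where xy: "c = (x, y)" by (cases c)
      then have "(x - 1, y + 1) \<in> t" using c by (simp add: mem_translate)
      then have "(x - 1, y + 1) \<in> below \<mu> - below lam"
        using \<open>t \<in> D\<close> \<open>\<Union>D = _\<close> by blast
      then have "0 \<le> y" using region_row_positive[OF assms, of "x - 1" "y + 1"] by simp
      then show ?thesis by (simp add: xy cell_below_path_iff)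
    qed
    then show ?thesis unfolding subset_eq by (rule ball_cong[OF refl])
  qed
  have "cover_inclusive lam D \<longleftrightarrow>
      (\<forall>t\<in>D. translate (1, - 1) t \<subseteq> below lam \<or>
             (\<exists>t'\<in>D. t' \<noteq> t \<and> translate (1, - 1) t \<subseteq> t'))"
    if "\<Union>D = below \<mu> - below lam"
    unfolding cover_inclusive_def by (rule ball_cong[OF refl]) (simp only: iff[OF that])
  then show ?thesis
    unfolding dyck_tiling_def region_below[OF assms]
    by (cases "\<Union>D = below \<mu> - below lam") simp_all
qed

text \<open>A tile has one cell on each antidiagonal that it meets, at a height given by the counting
  function of its path.\<close>

lemma mem_tile:
  "(x, y) \<in> translate (a, b) (points p) \<longleftrightarrow>
     a + b \<le> x + y \<and> x + y \<le> a + b + int (length p) \<and>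
     y - b = int (ups p (nat (x + y - a - b)))"
proof -
  have "(x - a, y - b) \<in> points p \<longleftrightarrow>
      (\<exists>i\<le>length p. x - a = int i - int (ups p i) \<and> y - b = int (ups p i))"
    by (auto simp: points_def point_ups image_iff)
  also have "\<dots> \<longleftrightarrow> (\<exists>i\<le>length p. x + y - a - b = int i \<and> y - b = int (ups p i))"
    by (rule arg_cong[of _ _ Ex]) auto
  also have "\<dots> \<longleftrightarrow> 0 \<le> x + y - a - b \<and> x + y - a - b \<le> int (length p) \<and>
      y - b = int (ups p (nat (x + y - a - b)))"
    by (auto intro!: exI[of _ "nat (x + y - a - b)"])
  finally show ?thesis by (auto simp: mem_translate)
qed

section \<open>Inserting an up step and k down steps along an antidiagonal\<close>

text \<open>The antidiagonals \<open>s - 1, \<dots>, s + k\<close> are squeezed onto the single antidiagonal \<open>s - 1\<close>: the cell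
  just before the inserted factor \<open>U D\<^sup>k\<close> and the \<open>k + 1\<close> cells on the factor all go to the same cell.
  Cells beyond move by \<open>(-k, -1)\<close>.\<close>

definition collapse :: "nat \<Rightarrow> int \<Rightarrow> cell \<Rightarrow> cell" where
  "collapse k s = (\<lambda>(x, y). if x + y < s then (x, y) else (x - min (int k) (x + y - s), y - 1))"

abbreviation expand :: "nat \<Rightarrow> int \<Rightarrow> cell set \<Rightarrow> cell set" where
  "expand k s S \<equiv> collapse k s -` S"

lemma collapse_low: "x + y < s \<Longrightarrow> collapse k s (x, y) = (x, y)"
  by (simp add: collapse_def)

lemma surj_collapse: "surj (collapse k s)"
proof (rule surjI)
  show "collapse k s (case c of (x, y) \<Rightarrow> if x + y < s then (x, y) else (x + int k, y + 1)) = c" for c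
    by (cases c) (auto simp: collapse_def)
qed

lemma expand_subset_iff: "expand k s A \<subseteq> expand k s B \<longleftrightarrow> A \<subseteq> B"
  by (metis surj_collapse surj_image_vimage_eq image_mono vimage_mono)

lemma expand_eq_iff: "expand k s A = expand k s B \<longleftrightarrow> A = B"
  by (metis surj_collapse surj_image_vimage_eq)

lemma expand_translate:
  "expand k s (translate (1, - 1) A) = translate (1, - 1) (expand k s A)"
proof (rule set_eqI)
  fix c
  show "c \<in> expand k s (translate (1, - 1) A) \<longleftrightarrow> c \<in> translate (1, - 1) (expand k s A)"
    by (cases c) (auto simp: collapse_def mem_translate algebra_simps)
qed

lemma expand_below:
  assumes "length p1 = s"
  shows "expand k (int s) (below (p1 @ p2)) = below (p1 @ Up # replicate k Down @ p2)"
proof (rule set_eqI)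
  fix c :: cell
  obtain x y where c: "c = (x, y)" by (cases c)
  show "c \<in> expand k (int s) (below (p1 @ p2)) \<longleftrightarrow>
      c \<in> below (p1 @ Up # replicate k Down @ p2)"
  proof (cases "x + y < int s")
    case True
    then show ?thesis using assms by (simp add: c collapse_low mem_below ups_insert nat_le_iff)
  next
    case False
    then have 1: "\<not> nat (x + y + 1) \<le> length p1" using assms by simp
    define x' where "x' = x - min (int k) (x + y - int s)"
    have 2: "nat (x' + (y - 1) + 1) = max (length p1) (nat (x + y + 1) - Suc k)"
      using False assms unfolding x'_def by linarith
    have 3: "collapse k (int s) c = (x', y - 1)" using False by (simp add: c collapse_def x'_def)
    show ?thesis
      unfolding vimage_eq 3 unfolding c mem_below ups_insert 2 if_not_P[OF 1] by auto
  qed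
qed

lemma expand_tile_at:
  assumes "a + b + int (length p1) = s - 1"
  shows "expand k s (translate (a, b) (points (p1 @ p2))) =
    translate (a, b) (points (p1 @ Up # replicate k Down @ p2))"
proof (rule set_eqI)
  fix c :: cell
  obtain x y where c: "c = (x, y)" by (cases c)
  show "c \<in> expand k s (translate (a, b) (points (p1 @ p2))) \<longleftrightarrow>
    c \<in> translate (a, b) (points (p1 @ Up # replicate k Down @ p2))"
  proof (cases "x + y < s")
    case True
    then show ?thesis using assms by (auto simp: c collapse_low mem_tile ups_insert nat_le_iff)
  next
    case False
    define x' where "x' = x - min (int k) (x + y - s)"
    have 1: "\<not> nat (x + y - a - b) \<le> length p1" using False assms by simp
    have 2: "nat (x' + (y - 1) - a - b) = max (length p1) (nat (x + y - a - b) - Suc k)"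
      using False assms unfolding x'_def by linarith
    have 3: "collapse k s c = (x', y - 1)" using False by (simp add: c collapse_def x'_def)
    have 4: "a + b \<le> x' + (y - 1) \<and> x' + (y - 1) \<le> a + b + int (length (p1 @ p2)) \<longleftrightarrow>
        a + b \<le> x + y \<and> x + y \<le> a + b + int (length (p1 @ Up # replicate k Down @ p2))"
    proof -
      have "a + b \<le> x' + (y - 1)" "a + b \<le> x + y"
        using False assms unfolding x'_def by linarith+
      moreover have "x' + (y - 1) \<le> s - 1 + int (length p2) \<longleftrightarrow>
          x + y \<le> s + int k + int (length p2)"
        using False unfolding x'_def by linarith
      ultimately show ?thesis using assms by auto
    qed
    show ?thesis
      unfolding vimage_eq 3 unfolding c mem_tile ups_insert 2 if_not_P[OF 1]
      using 4 by auto
  qed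
qed

lemma expand_low:
  assumes "\<And>x y. (x, y) \<in> S \<Longrightarrow> x + y < s - 1"
  shows "expand k s S = S"
proof (rule set_eqI)
  fix c :: cell
  obtain x y where c: "c = (x, y)" by (cases c)
  show "c \<in> expand k s S \<longleftrightarrow> c \<in> S"
    using assms[of x y] assms[of "x - min (int k) (x + y - s)" "y - 1"]
    by (auto simp: c collapse_def split: if_splits)
qed

lemma expand_high:
  assumes "\<And>x y. (x, y) \<in> S \<Longrightarrow> s \<le> x + y"
  shows "expand k s S = translate (int k, 1) S"
proof (rule set_eqI)
  fix c :: cell
  obtain x y where c: "c = (x, y)" by (cases c)
  show "c \<in> expand k s S \<longleftrightarrow> c \<in> translate (int k, 1) S"
    using assms[of x y] assms[of "x - min (int k) (x + y - s)" "y - 1"] assms[of "x - int k" "y - 1"]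
    by (auto simp: c collapse_def mem_translate min_def split: if_splits)
qed

lemma translate_translate: "translate (a, b) (translate (a', b') S) = translate (a + a', b + b') S"
  by (auto simp: set_eq_iff mem_translate algebra_simps)

lemma translate_0 [simp]: "translate (0, 0) S = S"
  by (auto simp: set_eq_iff mem_translate)

lemma dyck_tile_translate:
  assumes "dyck_tile k t" shows "dyck_tile k (translate v t)"
proof -
  obtain m p a b where "dyck_path k m p" "t = translate (a, b) (points p)"
    using assms by (auto simp: dyck_tile_def)
  then show ?thesis
    by (cases v) (auto simp: dyck_tile_def translate_translate)
qed

text \<open>A tile that meets the antidiagonal \<open>s - 1\<close> is cut open and grows; any other tile stays in
  place or moves as a whole.\<close>

lemma dyck_tile_expand:
  assumes "dyck_tile k t"
  shows "dyck_tile k (expand k s t)"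
proof -
  obtain m p a b where p: "dyck_path k m p" and t: "t = translate (a, b) (points p)"
    using assms by (auto simp: dyck_tile_def)
  consider "s \<le> a + b" | "a + b + int (length p) < s - 1"
    | "a + b \<le> s - 1" "s - 1 \<le> a + b + int (length p)" by linarith
  then show ?thesis
  proof cases
    case 1
    then have "expand k s t = translate (int k, 1) t"
      by (intro expand_high) (auto simp: t mem_tile)
    then show ?thesis using assms by (simp add: dyck_tile_translate)
  next
    case 2
    then have "expand k s t = t" by (intro expand_low) (auto simp: t mem_tile)
    then show ?thesis using assms by simp
  next
    case 3
    define r where "r = nat (s - 1 - a - b)"
    have "expand k s (translate (a, b) (points (take r p @ drop r p))) =
        translate (a, b) (points (take r p @ Up # replicate k Down @ drop r p))"
      using 3 by (intro expand_tile_at) (auto simp: r_def)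
    moreover have "dyck_path k (Suc m) (take r p @ Up # replicate k Down @ drop r p)"
      using p by (simp add: dyck_path_insert)
    ultimately show ?thesis unfolding dyck_tile_def t by auto
  qed
qed

text \<open>A tile crosses at \<open>(x, y)\<close> if its path has an up step into \<open>(x, y)\<close> followed by \<open>k\<close> down
  steps.\<close>

definition crosses :: "nat \<Rightarrow> cell set \<Rightarrow> cell \<Rightarrow> bool" where
  "crosses k t = (\<lambda>(x, y). (x, y - 1) \<in> t \<and> (\<forall>r\<in>{0..int k}. (x + r, y) \<in> t))"

text \<open>Only the squeezed strip can obstruct the contraction: a tile outside of it stays or moves as a
  whole, and from a tile that runs through it along \<open>U D\<^sup>k\<close> this factor can be deleted.\<close>

lemma contract_tile:
  assumes "dyck_tile k t"
    and cross: "\<And>x y. (x, y) \<in> t \<Longrightarrow> s - 1 \<le> x + y \<Longrightarrow> x + y \<le> s + int k \<Longrightarrow>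
      \<exists>x y. x + y = s \<and> crosses k t (x, y)"
  obtains t' where "dyck_tile k t'" and "t = expand k s t'"
proof -
  obtain m p a b where p: "dyck_path k m p" and t: "t = translate (a, b) (points p)"
    using assms(1) by (auto simp: dyck_tile_def)
  consider "s + int k < a + b" | "a + b + int (length p) < s - 1"
    | "a + b \<le> s + int k" "s - 1 \<le> a + b + int (length p)" by linarith
  then show ?thesis
  proof cases
    case 1
    then have "expand k s (translate (- int k, - 1) t) = translate (int k, 1) (translate (- int k, - 1) t)"
      by (intro expand_high) (auto simp: t translate_translate mem_tile)
    then have "t = expand k s (translate (- int k, - 1) t)" by (simp add: translate_translate)
    then show ?thesis using that assms(1) dyck_tile_translate by blast
  next
    case 2
    then have "expand k s t = t" by (intro expand_low) (auto simp: t mem_tile)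
    then show ?thesis using that[of t] assms(1) by simp
  next
    case 3
    define l where "l = max (s - 1) (a + b)"
    define u where "u = int (ups p (nat (l - a - b)))"
    have "(l - b - u, b + u) \<in> t"
      using 3 by (auto simp: t mem_tile l_def u_def)
    then obtain x y where xy: "x + y = s" and c: "crosses k t (x, y)"
      using cross[of "l - b - u" "b + u"] 3 by (auto simp: l_def)
    have c1: "(x, y - 1) \<in> t" and row: "\<forall>r\<in>{0..int k}. (x + r, y) \<in> t"
      using c by (auto simp: crosses_def)
    have c2: "(x, y) \<in> t" and c3: "(x + int k, y) \<in> t"
      using row[rule_format, of 0] row[rule_format, of "int k"] by auto
    define r where "r = nat (s - 1 - a - b)"
    have r: "int r = s - 1 - a - b" using c1 xy by (auto simp: t mem_tile r_def)
    have n1: "nat (x + (y - 1) - a - b) = r" "nat (x + y - a - b) = Suc r"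
      "nat (x + int k + y - a - b) = r + Suc k" using xy r by auto
    have "r + Suc k \<le> length p" using c3 xy r by (auto simp: t mem_tile)
    moreover have "y - 1 - b = int (ups p r)" using c1 by (simp add: t mem_tile n1)
    moreover have "y - b = int (ups p (Suc r))" using c2 by (simp add: t mem_tile n1)
    moreover have "y - b = int (ups p (r + Suc k))" using c3 unfolding t mem_tile n1 by simp
    ultimately have "r + Suc k \<le> length p" "ups p r < ups p (Suc r)"
      "ups p (r + Suc k) \<le> ups p (Suc r)" by linarith+
    then obtain p1 p2 where p12: "p = p1 @ Up # replicate k Down @ p2" "length p1 = r"
      by (rule split_at_up_downs)
    have "ups p (length p) \<noteq> 0" by (simp add: p12 ups_insert)
    then obtain m' where "m = Suc m'" using p by (cases m) (auto simp: dyck_path_ups)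
    then have "dyck_path k m' (p1 @ p2)" using p by (simp add: p12 dyck_path_insert)
    then have "dyck_tile k (translate (a, b) (points (p1 @ p2)))" by (auto simp: dyck_tile_def)
    moreover have "t = expand k s (translate (a, b) (points (p1 @ p2)))"
      using expand_tile_at[of a b p1 s k p2] r by (simp add: t p12)
    ultimately show ?thesis by (rule that)
  qed
qed


section \<open>Adding a top row\<close>

lemma ups_append_downs: "ups (p @ replicate d Down) i = ups p i"
proof -
  have "count_list (replicate d Down) Up = 0" for d
    by (induction d) auto
  then show ?thesis by (simp add: ups_def)
qed

lemma ups_Up_replicate:
  "ups (p @ Up # replicate d Down) i = (if i \<le> length p then ups p i else Suc (ups p (length p)))"
  using ups_insert[of p d "[]" i] ups_ge_length[of p "max (length p) (i - Suc d)"] by simp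

lemma path_weakly_above_ups:
  "path_weakly_above \<mu> lam \<longleftrightarrow> length \<mu> = length lam \<and> (\<forall>i. ups lam i \<le> ups \<mu> i)"
proof -
  have "(\<forall>i\<le>length \<mu>. snd (point lam i) \<le> snd (point \<mu> i)) \<longleftrightarrow> (\<forall>i. ups lam i \<le> ups \<mu> i)"
    if len: "length \<mu> = length lam"
  proof -
    have "(\<forall>i\<le>length \<mu>. snd (point lam i) \<le> snd (point \<mu> i)) \<longleftrightarrow>
        (\<forall>i\<le>length \<mu>. ups lam i \<le> ups \<mu> i)"
      using len by (simp add: point_ups)
    also have "\<dots> \<longleftrightarrow> (\<forall>i. ups lam i \<le> ups \<mu> i)"
    proof (intro iffI allI)
      fix i assume "\<forall>i\<le>length \<mu>. ups lam i \<le> ups \<mu> i"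
      then show "ups lam i \<le> ups \<mu> i"
        using ups_ge_length[of \<mu> i] ups_ge_length[of lam i] len by (cases "i \<le> length \<mu>") auto
    qed simp
    finally show ?thesis .
  qed
  then show ?thesis by (auto simp: path_weakly_above_def)
qed

lemma below_mono:
  assumes "\<And>i. ups lam i \<le> ups \<mu> i"
  shows "below lam \<subseteq> below \<mu>"
proof
  fix c assume "c \<in> below lam"
  then show "c \<in> below \<mu>"
    using assms[of "nat (fst c + snd c + 1)"] by (cases c) (simp add: mem_below)
qed

lemma dyck_tile_singleton: "dyck_tile k {c}"
  unfolding dyck_tile_def
  by (rule exI[of _ 0], rule exI[of _ "[]"], rule exI[of _ c])
    (auto simp: dyck_path_ups points_def point_def translate_def split: prod.splits)

lemma dyck_tile_nonempty: "dyck_tile k t \<Longrightarrow> t \<noteq> {}"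
  by (auto simp: dyck_tile_def points_def translate_def split: prod.splits)

lemma finite_region:
  assumes "dyck_path k n lam" and "dyck_path k n \<mu>"
  shows "finite (below \<mu> - below lam)"
proof (rule finite_subset)
  show "below \<mu> - below lam \<subseteq>
      (\<lambda>(l, y). (int l - y, y)) ` ({..length \<mu>} \<times> {0..int n})"
  proof
    fix c assume c: "c \<in> below \<mu> - below lam"
    obtain x y where xy: "c = (x, y)" by (cases c)
    have y: "0 < y" using region_row_positive[OF assms] c xy by blast
    have len: "length lam = length \<mu>" "ups lam (length lam) = n" "ups \<mu> (length \<mu>) = n"
      using assms by (auto simp: dyck_path_ups)
    define l where "l = nat (x + y + 1)"
    have 1: "y + 1 \<le> int (ups \<mu> l)" and 2: "int (ups lam l) < y + 1"
      using c by (auto simp: xy mem_below l_def)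
    have "y \<le> int n" using 1 ups_le_total[of \<mu> l] len by simp
    have "l \<noteq> 0" using 1 y by (cases l) auto
    then have l: "x = int (l - 1) - y" unfolding l_def by linarith
    have "l \<le> length \<mu>"
      using 1 2 ups_ge_length[of \<mu> l] ups_ge_length[of lam l] len by (cases "l \<le> length \<mu>") auto
    then show "c \<in> (\<lambda>(l, y). (int l - y, y)) ` ({..length \<mu>} \<times> {0..int n})"
      using y \<open>y \<le> int n\<close> by (auto simp: xy l intro!: image_eqI[of _ _ "(l - 1, y)"])
  qed
qed simp

lemma finite_dyck_tiling:
  assumes "D \<in> dyck_tilings k n \<mu>" and "dyck_path k n \<mu>"
  shows "finite D"
proof -
  obtain lam where lam: "dyck_path k n lam" "dyck_tiling k lam \<mu> D"
    using assms(1) by (auto simp: dyck_tilings_def)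
  then have "\<Union>D = below \<mu> - below lam" using assms(2) dyck_tiling_iff by blast
  then show ?thesis using finite_region[OF lam(1) assms(2)] finite_UnionD by metis
qed

text \<open>The setting of the induction step. The run of down steps after the last up step
  has length at least \<open>k\<close>, so that \<open>k\<close> of them can be removed together with that up step.\<close>

locale last_up_step =
  fixes k n j :: nat and p :: path
  assumes dyck: "dyck_path k (Suc n) (p @ Up # replicate j Down)"
begin

abbreviation mu :: path where "mu \<equiv> p @ Up # replicate j Down"
abbreviation mu' :: path where "mu' \<equiv> p @ replicate (j - k) Down"
abbreviation m :: nat where "m \<equiv> length p"

definition top_cell :: "nat \<Rightarrow> cell" where
  "top_cell i = (int m - int n + int i, int n)"

definition grow :: "nat \<Rightarrow> cell set set \<Rightarrow> cell set set" where
  "grow h D = expand k (int (m + h)) ` D \<union> (\<lambda>i. {top_cell i}) ` {..<h}"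

lemma ups_p: "ups p m = n"
  using dyck by (simp add: dyck_path_ups ups_Up_replicate)

lemma length_mu: "m + Suc j = Suc k * Suc n"
  using dyck by (simp add: dyck_path_ups)

lemma k_le_j: "k \<le> j"
proof -
  have "m \<le> Suc k * ups mu m" using dyck unfolding dyck_path_ups by simp
  then have "m \<le> Suc k * n" by (simp add: ups_Up_replicate ups_p)
  then show ?thesis using length_mu by simp
qed

lemma dyck': "dyck_path k n mu'"
proof -
  have "mu = p @ Up # replicate k Down @ replicate (j - k) Down"
    using k_le_j by (simp flip: replicate_add)
  then show ?thesis using dyck dyck_path_insert by metis
qed

lemma length_mu': "m + (j - k) = Suc k * n"
  using length_mu k_le_j by simp

lemma mem_below_mu': "(x, y) \<in> below mu' \<longleftrightarrow> y + 1 \<le> int (ups p (nat (x + y + 1)))"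
  by (simp add: mem_below ups_append_downs)

text \<open>Past the end of \<open>p\<close> only the top row distinguishes the two upper paths.\<close>

lemma mem_below_mu:
  "(x, y) \<in> below mu \<longleftrightarrow> (if x + y < int m then (x, y) \<in> below mu' else y \<le> int n)"
  unfolding mem_below_mu' unfolding mem_below ups_Up_replicate ups_p by auto

lemma below_mu'_high: "int m \<le> x + y + 1 \<Longrightarrow> (x, y) \<in> below mu' \<longleftrightarrow> y < int n"
  using ups_ge_length[of p "nat (x + y + 1)"] by (auto simp: mem_below_mu' ups_p)

lemma below_mu'_row: "(x, y) \<in> below mu' \<Longrightarrow> y < int n"
  using ups_le_total[of p "nat (x + y + 1)"] by (auto simp: mem_below_mu' ups_p)

lemma below_mu_row: "(x, y) \<in> below mu \<Longrightarrow> y \<le> int n"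
  using below_mu'_row[of x y] by (auto simp: mem_below_mu split: if_splits)

lemma mem_expand_mu':
  "(x, y) \<in> expand k (int (m + h)) (below mu') \<longleftrightarrow>
     (if x + y < int (m + h) then (x, y) \<in> below mu' else y \<le> int n)"
proof (cases "x + y < int (m + h)")
  case True
  then show ?thesis by (simp add: collapse_low)
next
  case False
  define x' where "x' = x - min (int k) (x + y - int (m + h))"
  have 1: "collapse k (int (m + h)) (x, y) = (x', y - 1)" using False by (simp add: collapse_def x'_def)
  have "int m \<le> x' + (y - 1) + 1" using False unfolding x'_def by linarith
  from below_mu'_high[OF this] show ?thesis using False by (simp only: vimage_eq 1) auto
qed

text \<open>Expanding the cells below \<open>\<mu>'\<close> gives the cells below \<open>p D\<^sup>h U D\<^sup>j\<^sup>-\<^sup>h\<close>, the path with the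
  insertion made after \<open>h\<close> down steps; \<open>\<mu>\<close> takes its last up step \<open>h\<close> columns earlier.\<close>

lemma below_mu_grow:
  "below mu = expand k (int (m + h)) (below mu') \<union> top_cell ` {..<h}"
proof (rule set_eqI)
  fix c :: cell
  obtain x y where c: "c = (x, y)" by (cases c)
  have "c \<in> top_cell ` {..<h} \<longleftrightarrow> y = int n \<and> int m \<le> x + y \<and> x + y < int (m + h)"
  proof
    assume "y = int n \<and> int m \<le> x + y \<and> x + y < int (m + h)"
    then show "c \<in> top_cell ` {..<h}"
      by (intro image_eqI[of _ _ "nat (x + y - int m)"]) (auto simp: c top_cell_def)
  qed (auto simp: c top_cell_def)
  then show "c \<in> below mu \<longleftrightarrow> c \<in> expand k (int (m + h)) (below mu') \<union> top_cell ` {..<h}"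
    unfolding c Un_iff mem_expand_mu' mem_below_mu
    using below_mu'_high[of x y] by (cases "x + y < int m") auto
qed

lemma top_cell_not_expanded: "i < h \<Longrightarrow> top_cell i \<notin> expand k (int (m + h)) (below mu')"
  using below_mu'_row unfolding top_cell_def mem_expand_mu' by fastforce

lemma top_cell_eq_iff [simp]: "top_cell i = top_cell i' \<longleftrightarrow> i = i'"
  by (simp add: top_cell_def)

lemma tiling_below_mu':
  assumes "D \<in> dyck_tilings k n mu'" and "t \<in> D"
  shows "t \<subseteq> below mu'"
  using assms dyck_tiling_iff[OF _ dyck'] by (fastforce simp: dyck_tilings_def)

text \<open>An expanded tile that contains the cell of the top row on antidiagonal \<open>s\<close> also contains the
  cell beneath it, because both collapse to the same cell. So a one-cell tile at position \<open>h\<close> of the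
  top row is impossible, and \<open>h\<close> can be read off as the length of the initial run of such tiles.\<close>

lemma expanded_top_cell:
  assumes "D \<in> dyck_tilings k n mu'" and "{top_cell i} \<in> expand k (int (m + h)) ` D"
  shows "h < i"
proof -
  obtain t where t: "t \<in> D" "expand k (int (m + h)) t = {top_cell i}"
    using assms(2) by auto
  have "\<not> i < h"
    using top_cell_not_expanded[of i h] tiling_below_mu'[OF assms(1) t(1)] t(2)
    by (metis insertI1 subsetD vimage_mono)
  moreover have "i \<noteq> h"
  proof
    assume i: "i = h"
    have "collapse k (int (m + h)) (int m - int n + int h, int n) = (int m - int n + int h, int n - 1)"
      by (simp add: collapse_def)
    moreover have "collapse k (int (m + h)) (int m - int n + int h, int n - 1) = (int m - int n + int h, int n - 1)"
      by (simp add: collapse_def)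
    ultimately have "(int m - int n + int h, int n - 1) \<in> expand k (int (m + h)) t"
      using t(2) i by (metis insertI1 top_cell_def vimageE vimageI2)
    then show False unfolding t(2) by (simp add: top_cell_def)
  qed
  ultimately show "h < i" by simp
qed

lemma expanded_disjoint:
  assumes "D \<in> dyck_tilings k n mu'"
  shows "expand k (int (m + h)) ` D \<inter> (\<lambda>i. {top_cell i}) ` {..<h} = {}"
proof (rule ccontr)
  assume "\<not> ?thesis"
  then obtain i where i: "i < h" "{top_cell i} \<in> expand k (int (m + h)) ` D" by blast
  show False using expanded_top_cell[OF assms i(2)] i(1) by linarith
qed

lemma grow_inj:
  assumes "D \<in> dyck_tilings k n mu'" and "D' \<in> dyck_tilings k n mu'" and "grow h D = grow h' D'"
  shows "h = h' \<and> D = D'"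
proof -
  have not: "{top_cell h} \<notin> grow h D" if "D \<in> dyck_tilings k n mu'" for h D
    using expanded_top_cell[OF that, of h h] unfolding grow_def by (auto simp del: of_nat_add)
  have yes: "{top_cell i} \<in> grow h D" if "i < h" for i h D
    using that by (auto simp: grow_def)
  have h: "h' = h"
  proof (cases h h' rule: linorder_cases)
    case less
    then show ?thesis using not[OF assms(1), of h] yes[of h h' D'] assms(3) by simp
  next
    case greater
    then show ?thesis using not[OF assms(2), of h'] yes[of h' h D] assms(3) by simp
  qed simp
  have old: "expand k (int (m + h)) ` D = grow h D - (\<lambda>i. {top_cell i}) ` {..<h}"
    if "D \<in> dyck_tilings k n mu'" for D
    unfolding grow_def Un_Diff Diff_cancel Diff_triv[OF expanded_disjoint[OF that]] by simp
  \<comment> \<open>With the same \<open>h\<close>, removing the new one-cell tiles leaves the expanded tiles, and expansion is injective.\<close>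
  have images: "expand k (int (m + h)) ` D = expand k (int (m + h)) ` D'"
    unfolding old[OF assms(1)] old[OF assms(2)] using assms(3) h by simp
  have "inj (\<lambda>t. expand k (int (m + h)) t)"
    by (rule injI) (simp only: expand_eq_iff)
  from inj_image_eq_iff[OF this, of D D'] images have "D = D'" by (rule iffD1)
  with h show ?thesis by blast
qed

lemma card_grow:
  assumes "D \<in> dyck_tilings k n mu'"
  shows "card (grow h D) = h + card D"
proof -
  have "finite D" using assms dyck' by (rule finite_dyck_tiling)
  moreover note expanded_disjoint[OF assms, of h]
  moreover have "card (expand k (int (m + h)) ` D) = card D"
    by (intro card_image inj_onI) (simp add: expand_eq_iff)
  moreover have "card ((\<lambda>i. {top_cell i}) ` {..<h}) = h"
    by (simp add: card_image inj_on_def)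
  ultimately show ?thesis unfolding grow_def by (subst card_Un_disjoint) auto
qed

text \<open>The new lower path is the old one with \<open>U D\<^sup>k\<close> inserted at \<open>s\<close>. The properties of the
  expanded tiles are inherited through the preimage. Each new one-cell tile, moved by \<open>(1, -1)\<close>, is again
  a single cell, lying under the expanded upper path, so it is either below the lower path or in
  some expanded tile.\<close>

lemma grow_tiling:
  assumes "h \<le> j - k" and "D \<in> dyck_tilings k n mu'"
  shows "grow h D \<in> dyck_tilings k (Suc n) mu"
proof -
  define s where "s = m + h"
  let ?E = "expand k (int s)"
  obtain lam' where lam': "dyck_path k n lam'" "path_weakly_above mu' lam'" "dyck_tiling k lam' mu' D"
    using assms(2) by (auto simp: dyck_tilings_def)
  define lam where "lam = take s lam' @ Up # replicate k Down @ drop s lam'"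
  have len': "length lam' = m + (j - k)" using lam'(2) by (simp add: path_weakly_above_ups)
  then have s: "length (take s lam') = s" using assms(1) by (simp add: s_def)
  have ups': "ups lam' i \<le> ups p i" for i
    using lam'(2) by (simp add: path_weakly_above_ups ups_append_downs)
  have lam: "dyck_path k (Suc n) lam" using lam'(1) by (simp add: lam_def dyck_path_insert)
  have E: "?E (below lam') = below lam"
    using expand_below[OF s, of k "drop s lam'"] by (simp add: lam_def)
  have "ups lam i \<le> ups mu i" for i
  proof (cases "i \<le> m")
    case True
    then have "i \<le> length (take s lam')" unfolding s by (simp add: s_def)
    then have "ups lam i = ups lam' i" unfolding lam_def ups_insert by simp
    then show ?thesis using True ups'[of i] by (simp add: ups_Up_replicate)
  next
    case False
    moreover have "ups lam (length lam) = Suc n" using lam unfolding dyck_path_ups by blast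
    ultimately show ?thesis
      using ups_le_total[of lam i] by (simp only: ups_Up_replicate ups_p if_False)
  qed
  then have above: "path_weakly_above mu lam"
    using lam dyck by (simp add: path_weakly_above_ups dyck_path_ups)
  have T: "\<forall>t\<in>D. dyck_tile k t" "pairwise disjnt D" "\<Union>D = below mu' - below lam'"
    and C: "\<forall>t\<in>D. translate (1, - 1) t \<subseteq> below lam' \<or>
           (\<exists>t'\<in>D. t' \<noteq> t \<and> translate (1, - 1) t \<subseteq> t')"
    using lam'(3) unfolding dyck_tiling_iff[OF lam'(1) dyck'] by auto
  have sub: "below lam' \<subseteq> below mu'"
    using ups' by (intro below_mono) (simp add: ups_append_downs)
  have top: "top_cell i \<notin> ?E t" if "i < h" "t \<in> D" for i t
  proof -
    have "t \<subseteq> below mu'" using T(3) that(2) by blast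
    then have "?E t \<subseteq> ?E (below mu')" unfolding expand_subset_iff .
    then show ?thesis using top_cell_not_expanded[OF that(1)] unfolding s_def by blast
  qed
  have union: "\<Union>(?E ` D) = ?E (below mu') - below lam"
    unfolding E[symmetric] vimage_Diff[symmetric] T(3)[symmetric] by (simp only: vimage_Union)
  have "dyck_tiling k lam mu (grow h D)"
    unfolding dyck_tiling_iff[OF lam dyck]
  proof (intro conjI ballI)
    fix t assume "t \<in> grow h D"
    then show "dyck_tile k t"
      using T(1) by (auto simp: grow_def dyck_tile_expand dyck_tile_singleton)
  next
    show "pairwise disjnt (grow h D)"
    proof (rule pairwiseI)
      fix t1 t2 assume t12: "t1 \<in> grow h D" "t2 \<in> grow h D" "t1 \<noteq> t2"
      have ee: "disjnt (?E a) (?E b)" if "a \<in> D" "b \<in> D" "?E a \<noteq> ?E b" for a b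
      proof -
        have "a \<noteq> b" using that(3) by blast
        then have "a \<inter> b = {}" using T(2) that by (simp add: pairwise_def disjnt_def)
        then show ?thesis unfolding disjnt_def vimage_Int[symmetric] by simp
      qed
      have es: "disjnt (?E a) {top_cell i}" "disjnt {top_cell i} (?E a)"
        if "i < h" "a \<in> D" for i a
        using top[OF that] unfolding disjnt_def by blast+
      have ss: "disjnt {top_cell i} {top_cell i'}" if "{top_cell i} \<noteq> {top_cell i'}" for i i'
        using that by auto
      have old_or_new: "(\<exists>a\<in>D. t = ?E a) \<or> (\<exists>i<h. t = {top_cell i})" if "t \<in> grow h D" for t
        using that unfolding grow_def s_def[symmetric] by blast
      show "disjnt t1 t2"
        using old_or_new[OF t12(1)] old_or_new[OF t12(2)] t12(3)
        by (elim disjE bexE exE conjE) (simp_all only: ee es ss not_False_eq_True)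
    qed
  next
    have "top_cell i \<notin> below lam" if "i < h" for i
    proof -
      have "below lam \<subseteq> ?E (below mu')" unfolding E[symmetric] expand_subset_iff by (rule sub)
      then show ?thesis using top_cell_not_expanded[OF that] unfolding s_def by blast
    qed
    then show "\<Union>(grow h D) = below mu - below lam"
      unfolding grow_def s_def[symmetric] Union_Un_distrib union
      unfolding below_mu_grow[of h] s_def[symmetric] by blast
  next
    fix t assume "t \<in> grow h D"
    then consider (old) t0 where "t0 \<in> D" "t = ?E t0" | (new) i where "i < h" "t = {top_cell i}"
      by (auto simp: grow_def s_def)
    then show "translate (1, - 1) t \<subseteq> below lam \<or>
        (\<exists>t'\<in>grow h D. t' \<noteq> t \<and> translate (1, - 1) t \<subseteq> t')"
    proof cases
      case old
      from C old(1) have "translate (1, - 1) t0 \<subseteq> below lam' \<or>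
          (\<exists>t'\<in>D. t' \<noteq> t0 \<and> translate (1, - 1) t0 \<subseteq> t')" by blast
      then show ?thesis
      proof
        assume "translate (1, - 1) t0 \<subseteq> below lam'"
        then have "translate (1, - 1) t \<subseteq> below lam"
          unfolding old(2) E[symmetric] expand_translate[symmetric] expand_subset_iff .
        then show ?thesis ..
      next
        assume "\<exists>t'\<in>D. t' \<noteq> t0 \<and> translate (1, - 1) t0 \<subseteq> t'"
        then obtain t' where t': "t' \<in> D" "t' \<noteq> t0" "translate (1, - 1) t0 \<subseteq> t'" by blast
        then have "?E t' \<in> grow h D" "?E t' \<noteq> t" "translate (1, - 1) t \<subseteq> ?E t'"
          unfolding grow_def s_def[symmetric] old(2) expand_translate[symmetric]
          by (simp_all only: expand_eq_iff expand_subset_iff UnI1 imageI not_False_eq_True)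
        then show ?thesis by blast
      qed
    next
      case new
      define c where "c = (int m - int n + int i + 1, int n - 1)"
      have c: "translate (1, - 1) t = {c}"
        by (auto simp: new(2) translate_def top_cell_def c_def)
      have "c \<in> ?E (below mu')"
        using below_mu'_high[of "int m - int n + int i + 1" "int n - 1"]
        unfolding c_def s_def mem_expand_mu' by simp
      then have "c \<in> below lam \<or> c \<in> \<Union>(?E ` D)" unfolding union by (simp only: Diff_iff) blast
      then have "c \<in> below lam \<or> (\<exists>t'\<in>?E ` D. c \<in> t')" unfolding Union_iff .
      moreover have "c \<notin> t" by (simp add: new(2) top_cell_def c_def)
      ultimately show ?thesis unfolding c grow_def s_def[symmetric] by blast
    qed
  qed
  then show ?thesis using lam above by (auto simp: dyck_tilings_def)
qed

section \<open>Removing the top row\<close>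

text \<open>A tile that starts in the top row cannot rise and therefore has only one cell. A larger
  tile whose first cell in the top row is \<open>(x, n)\<close> must enter it by its last up step. Before
  that step, its path of size \<open>M\<close> has made at most \<open>(k + 1) (M - 1)\<close> steps, so at least \<open>k\<close> steps remain
  afterwards, and all of them are down steps.\<close>

lemma top_tile_crosses:
  assumes t: "dyck_tile k t" and rows: "\<And>x y. (x, y) \<in> t \<Longrightarrow> y \<le> int n"
    and top: "(x, int n) \<in> t" and not_single: "t \<noteq> {(x, int n)}" and left: "(x - 1, int n) \<notin> t"
  shows "crosses k t (x, int n)"
proof -
  obtain a b M r where r: "dyck_path k M r" and t: "t = translate (a, b) (points r)"
    using t by (auto simp: dyck_tile_def)
  define L where "L = nat (x + int n - a - b)"
  have top': "a + b \<le> x + int n" "x + int n \<le> a + b + int (length r)"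
    "int n - b = int (ups r L)"
    using top by (auto simp: t mem_tile L_def)
  have L: "int L = x + int n - a - b" using top'(1) by (simp add: L_def)
  have total: "ups r (length r) = M" and len: "length r = Suc k * M"
    using r by (auto simp only: dyck_path_ups)
  have "(a + int (length r) - int M, b + int M) \<in> t"
    using total by (simp add: t mem_tile)
  then have "b + int M \<le> int n" by (rule rows)
  then have full: "ups r L = M" using ups_le_total[of r L] top'(3) total by simp
  have "L \<noteq> 0"
  proof
    assume "L = 0"
    then have "r = []" using full len by (cases M) auto
    then have "t = {(x, int n)}"
      using L \<open>L = 0\<close> top' by (auto simp: t translate_def points_def point_def)
    then show False using not_single by simp
  qed
  then obtain L' where L': "L = Suc L'" by (cases L) auto
  have n': "nat (x - 1 + int n - a - b) = L'" "nat (x + (int n - 1) - a - b) = L'"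
    using L L' by auto
  have "ups r L' \<noteq> M"
  proof
    assume "ups r L' = M"
    then have "(x - 1, int n) \<in> t" using top' full L L' unfolding t mem_tile n' by simp
    then show False using left by simp
  qed
  then have prev: "Suc (ups r L') = M" using full by (auto simp: L' ups_Suc split: if_splits)
  have "L' \<le> Suc k * ups r L'"
    using r top'(2) L L' by (auto simp only: dyck_path_ups)
  then have space: "L + k \<le> length r" using len prev L' by auto
  have "(x, int n - 1) \<in> t" using top' full prev L L' unfolding t mem_tile n' by auto
  moreover have "(x + d, int n) \<in> t" if "d \<in> {0..int k}" for d
  proof -
    have e: "nat (x + d + int n - a - b) = L + nat d" using L that by auto
    have "ups r (L + nat d) = M"
      using ups_mono[of L "L + nat d" r] ups_le_total[of r "L + nat d"] full total by simp
    then show ?thesis using top' full space that L unfolding t mem_tile e by auto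
  qed
  ultimately show ?thesis by (simp add: crosses_def)
qed

text \<open>The run of one-cell tiles at the start of the top row has length \<open>h\<close>. By induction down the
  antidiagonal \<open>s\<close>, each of its cells in the region is entered by an up step of its tile and left
  by \<open>k\<close> down steps. Apart from the last cell of the run, the region cells on the
  antidiagonals \<open>s - 1, \<dots>, s + k\<close> all belong to these crossings, so no other tile can interfere,
  and every tile outside the run is expanded from a smaller one.\<close>

lemma grow_surj:
  assumes "D \<in> dyck_tilings k (Suc n) mu"
  shows "\<exists>h\<le>j - k. \<exists>D'\<in>dyck_tilings k n mu'. D = grow h D'"
proof -
  obtain lam where lam: "dyck_path k (Suc n) lam" "path_weakly_above mu lam" "dyck_tiling k lam mu D"
    using assms by (auto simp: dyck_tilings_def)
  have len: "length lam = Suc k * Suc n" and total: "ups lam (length lam) = Suc n"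
    and above_line: "\<And>i. i \<le> length lam \<Longrightarrow> i \<le> Suc k * ups lam i"
    using lam(1) unfolding dyck_path_ups by auto
  have ups_lam: "ups lam i \<le> ups mu i" for i using lam(2) by (simp add: path_weakly_above_ups)
  have T: "\<forall>t\<in>D. dyck_tile k t" "pairwise disjnt D" "\<Union>D = below mu - below lam"
    and C: "\<forall>t\<in>D. translate (1, - 1) t \<subseteq> below lam \<or>
           (\<exists>t'\<in>D. t' \<noteq> t \<and> translate (1, - 1) t \<subseteq> t')"
    using lam(3) unfolding dyck_tiling_iff[OF lam(1) dyck] by auto
  have eq: "t = t'" if "t \<in> D" "t' \<in> D" "c \<in> t" "c \<in> t'" for t t' c
    using T(2) that unfolding pairwise_def disjnt_def by blast
  have row: "y \<le> int n" if "(x, y) \<in> t" "t \<in> D" for x y t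
    using T(3) that by (intro below_mu_row) auto
  \<comment> \<open>The cell at position \<open>j - k\<close> lies beyond the line, hence outside the region, so the run stops before it.\<close>
  have end_below: "top_cell (j - k) \<in> below lam"
  proof -
    have "m + (j - k) + 1 \<le> length lam" using length_mu k_le_j len by simp
    from above_line[OF this] have "Suc k * n < Suc k * ups lam (m + (j - k) + 1)"
      using length_mu' by linarith
    then have "n < ups lam (m + (j - k) + 1)" by (simp only: mult_less_cancel1)
    moreover have "nat (int m - int n + int (j - k) + int n + 1) = m + (j - k) + 1" by simp
    ultimately show ?thesis by (simp only: top_cell_def mem_below)
  qed
  define h where "h = (LEAST h. {top_cell h} \<notin> D)"
  have ex: "{top_cell (j - k)} \<notin> D" using end_below T(3) by blast
  have h: "h \<le> j - k" unfolding h_def using ex by (rule Least_le)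
  have top_h: "{top_cell h} \<notin> D" unfolding h_def using ex by (rule LeastI)
  have top: "{top_cell i} \<in> D" if "i < h" for i
    using not_less_Least[of i "\<lambda>h. {top_cell h} \<notin> D"] that by (auto simp: h_def)
  define s where "s = m + h"
  let ?E = "expand k (int s)"
  let ?new = "(\<lambda>i. {top_cell i}) ` {..<h}"
  \<comment> \<open>What precedes position \<open>h\<close> of the top row: the last tile of the run, or no cell of the region.\<close>
  have before_top: "{(x - 1, int n)} \<in> D \<or> (x - 1, int n) \<notin> below mu"
    if "x + int n = int s" for x
  proof (cases h)
    case 0
    then have "x - 1 + int n < int m" using that by (simp add: s_def)
    then show ?thesis using below_mu'_row[of "x - 1" "int n"] by (auto simp: mem_below_mu)
  next
    case (Suc i)
    then have "(x - 1, int n) = top_cell i" using that by (simp add: s_def top_cell_def)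
    then show ?thesis using top[of i] Suc by simp
  qed
  \<comment> \<open>Induction downwards along the antidiagonal; each step uses cover-inclusiveness once.\<close>
  have chain: "\<exists>t\<in>D. crosses k t (x, y)"
    if "x + y = int s" "(x, y) \<notin> below lam" "y = int n - int i" for i x y
    using that
  proof (induction i arbitrary: x y)
    case 0
    then have y: "y = int n" by simp
    have xy: "(x, y) = top_cell h" using 0 by (simp add: top_cell_def s_def)
    have "(x, y) \<in> below mu" using 0 by (simp add: mem_below_mu s_def)
    then have "(x, int n) \<in> \<Union>D" unfolding T(3) using 0(2) y by simp
    then obtain t where t: "t \<in> D" "(x, int n) \<in> t" by blast
    have "(x - 1, int n) \<notin> t"
    proof
      assume *: "(x - 1, int n) \<in> t"
      moreover have "x + int n = int s" using 0(1) y by simp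
      ultimately have "{(x - 1, int n)} \<in> D" using before_top[of x] t(1) T(3) by blast
      from eq[OF t(1) this *] show False using t(2) by simp
    qed
    moreover have "t \<noteq> {(x, int n)}" using top_h t(1) xy y by auto
    ultimately have "crosses k t (x, int n)"
      using top_tile_crosses[of t x] T(1) row[OF _ t(1)] t by blast
    then show ?case using t(1) y by blast
  next
    case (Suc i)
    have "(x - 1, y + 1) \<notin> below lam"
      using below_diagonal[of "x - 1" "y + 1" lam] Suc.prems(2) by auto
    moreover have "x - 1 + (y + 1) = int s" "y + 1 = int n - int i" using Suc.prems(1,3) by auto
    ultimately obtain t where t: "t \<in> D" "crosses k t (x - 1, y + 1)"
      using Suc.IH[of "x - 1" "y + 1"] by blast
    have shifted: "(x, y - 1) \<in> translate (1, - 1) t"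
      "\<forall>d\<in>{0..int k}. (x + d, y) \<in> translate (1, - 1) t"
      using t(2) by (auto simp: crosses_def mem_translate algebra_simps)
    have "(x, y) \<in> translate (1, - 1) t" using shifted(2)[rule_format, of 0] by simp
    then obtain t' where t': "t' \<in> D" "translate (1, - 1) t \<subseteq> t'"
      using C t(1) Suc.prems(2) by blast
    have "crosses k t' (x, y)" using shifted t'(2) unfolding crosses_def prod.case by blast
    then show ?case using t'(1) by blast
  qed
  have chain': "\<exists>t\<in>D. crosses k t (x, y)"
    if "x + y = int s" "(x, y) \<notin> below lam" "y \<le> int n" for x y
    using chain[OF that(1,2), of "nat (int n - y)"] that(3) by simp
  \<comment> \<open>Outside the run, every region cell of the strip lies in a crossing tile, so its tile is that one.\<close>
  have contract: "\<exists>t'. dyck_tile k t' \<and> t = ?E t'" if t: "t \<in> D - ?new" for t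
  proof -
    have cross: "\<exists>x y. x + y = int s \<and> crosses k t (x, y)"
      if xy: "(x, y) \<in> t" "int s - 1 \<le> x + y" "x + y \<le> int s + int k" for x y
    proof -
      have y: "y \<le> int n" using row xy(1) t by blast
      have lam_xy: "(x, y) \<notin> below lam" and mu_xy: "(x, y) \<in> below mu" using T(3) t xy(1) by auto
      show ?thesis
      proof (cases "int s \<le> x + y")
        case True
        define d where "d = x + y - int s"
        have d: "x - d + y = int s" by (simp add: d_def)
        have "(x - d, y) \<notin> below lam"
          using below_right[of "x - d" y lam x] lam_xy True by (auto simp: d_def)
        then obtain t' where t': "t' \<in> D" "crosses k t' (x - d, y)" using chain'[OF d _ y] by blast
        moreover have "d \<in> {0..int k}" using True xy(3) by (simp add: d_def)
        ultimately have "(x - d + d, y) \<in> t'" unfolding crosses_def prod.case by blast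
        then have "t' = t" using eq[of t' t "(x, y)"] t' t xy(1) by auto
        then show ?thesis using t' d by blast
      next
        case False
        then have s1: "x + (y + 1) = int s" using xy(2) by simp
        have "y \<noteq> int n"
        proof
          assume yn: "y = int n"
          then have "{(x, y)} \<in> D" using before_top[of "x + 1"] s1 mu_xy by auto
          then have "t = {(x, y)}" using eq[of t "{(x, y)}" "(x, y)"] t xy(1) by auto
          moreover have "x + int n \<ge> int m"
            using mu_xy below_mu'_row[of x y] yn by (auto simp: mem_below_mu split: if_splits)
          then have "(x, y) = top_cell (nat (x + int n - int m))" "nat (x + int n - int m) < h"
            using s1 yn by (auto simp: top_cell_def s_def)
          ultimately show False using t by auto
        qed
        moreover have "(x, y + 1) \<notin> below lam" using below_down lam_xy by blast
        ultimately obtain t' where t': "t' \<in> D" "crosses k t' (x, y + 1)"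
          using chain'[OF s1] y by auto
        then have "(x, y) \<in> t'" by (simp add: crosses_def)
        then have "t' = t" using eq[of t' t "(x, y)"] t' t xy(1) by auto
        then show ?thesis using t' s1 by blast
      qed
    qed
    have "dyck_tile k t" using T(1) t by blast
    then obtain t' where "dyck_tile k t'" "t = ?E t'" using cross by (rule contract_tile)
    then show ?thesis by blast
  qed
  \<comment> \<open>The cell resting on the lower path at antidiagonal \<open>s\<close> belongs to a crossing tile, which forces
    the lower path to make the steps \<open>U D\<^sup>k\<close> there; if \<open>Y = n + 1\<close>, the path instead reaches its full
    height with this up step.\<close>
  obtain p1 p2 where p12: "lam = p1 @ Up # replicate k Down @ p2" "length p1 = s"
  proof -
    define Y where "Y = ups lam (Suc s)"
    have "s + Suc k \<le> length lam" using h length_mu k_le_j len by (simp add: s_def)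
    moreover have "ups lam s < Y \<and> ups lam (s + Suc k) \<le> Y"
    proof (cases "Y \<le> n")
      case True
      have sY: "int s - int Y + int Y = int s" by simp
      have "(int s - int Y, int Y) \<notin> below lam" by (simp add: mem_below Y_def nat_add_distrib)
      then obtain t where t: "t \<in> D" "crosses k t (int s - int Y, int Y)"
        using chain'[OF sY] True by auto
      then have "(int s - int Y, int Y - 1) \<in> t" "(int s - int Y + int k, int Y) \<in> t"
        unfolding crosses_def prod.case by simp_all
      then have "(int s - int Y, int Y - 1) \<notin> below lam" "(int s - int Y + int k, int Y) \<notin> below lam"
        using T(3) t(1) by blast+
      moreover have "nat (int s - int Y + (int Y - 1) + 1) = s"
        "nat (int s - int Y + int k + int Y + 1) = s + Suc k" by auto
      ultimately show ?thesis by (simp only: mem_below) linarith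
    next
      case False
      have "Y \<le> Suc n" using ups_le_total[of lam "Suc s"] total by (simp only: Y_def)
      with False have Y: "Y = Suc n" by simp
      have "ups lam s \<le> n"
      proof (cases h)
        case 0
        then show ?thesis using ups_lam[of m] by (simp add: s_def ups_Up_replicate ups_p)
      next
        case (Suc i)
        then have "top_cell i \<notin> below lam" using top[of i] T(3) by auto
        moreover have "nat (int m - int n + int i + int n + 1) = s" using Suc by (simp add: s_def)
        ultimately show ?thesis by (simp only: top_cell_def mem_below)
      qed
      moreover have "ups lam (s + Suc k) \<le> Suc n"
        using ups_le_total[of lam "s + Suc k"] total by (simp only:)
      ultimately show ?thesis using Y by simp
    qed
    ultimately show ?thesis using that split_at_up_downs[of s k lam] by (auto simp: Y_def)
  qed
  define lam' where "lam' = p1 @ p2"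
  have lam': "dyck_path k n lam'" using lam(1) by (simp add: lam'_def p12(1) dyck_path_insert)
  have E: "?E (below lam') = below lam"
    unfolding lam'_def p12(1) using p12(2) by (rule expand_below)
  have "ups lam' i \<le> ups p i" for i
  proof (cases "i \<le> m")
    case True
    then have "ups lam' i = ups lam i"
      using p12(2) by (simp add: lam'_def p12(1) ups_insert s_def)
    then show ?thesis using ups_lam[of i] True by (simp add: ups_Up_replicate)
  next
    case False
    have "ups lam' (length lam') = n" using lam' unfolding dyck_path_ups by blast
    then show ?thesis using ups_le_total[of lam' i] ups_ge_length[of p i] False ups_p by simp
  qed
  moreover have "length lam' = length mu'" using lam' dyck' unfolding dyck_path_ups by simp
  ultimately have above': "path_weakly_above mu' lam'"
    by (simp add: path_weakly_above_ups ups_append_downs)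
  define D' where "D' = {t. ?E t \<in> D - ?new}"
  have D': "?E ` D' = D - ?new"
  proof
    show "?E ` D' \<subseteq> D - ?new" unfolding D'_def by blast
    show "D - ?new \<subseteq> ?E ` D'"
    proof
      fix t assume t: "t \<in> D - ?new"
      then obtain t' where t': "t = ?E t'" using contract by blast
      then have "t' \<in> D'" using t by (simp only: D'_def mem_Collect_eq)
      then show "t \<in> ?E ` D'" unfolding t' by (rule imageI)
    qed
  qed
  have "D = grow h D'"
    unfolding grow_def s_def[symmetric] D' using top by blast
  moreover have "dyck_tiling k lam' mu' D'"
    unfolding dyck_tiling_iff[OF lam' dyck']
  proof (intro conjI ballI)
    fix t assume "t \<in> D'"
    then obtain t' where "dyck_tile k t'" "?E t = ?E t'"
      using contract[of "?E t"] unfolding D'_def by blast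
    then show "dyck_tile k t" by (simp only: expand_eq_iff)
  next
    show "pairwise disjnt D'"
    proof (rule pairwiseI)
      fix t1 t2 assume t12: "t1 \<in> D'" "t2 \<in> D'" "t1 \<noteq> t2"
      then have "?E t1 \<noteq> ?E t2" by (simp only: expand_eq_iff not_False_eq_True)
      moreover have "?E t1 \<in> D" "?E t2 \<in> D" using t12(1,2) unfolding D'_def by blast+
      ultimately have "disjnt (?E t1) (?E t2)" using T(2) by (rule_tac pairwiseD)
      then have "?E (t1 \<inter> t2) = ?E {}" by (simp only: disjnt_def vimage_Int vimage_empty)
      then show "disjnt t1 t2" unfolding expand_eq_iff disjnt_def .
    qed
  next
    have "?E (\<Union>D') = \<Union>(D - ?new)" unfolding D'[symmetric] by (simp only: vimage_Union)
    also have "\<dots> = \<Union>D - top_cell ` {..<h}"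
    proof -
      have "c \<notin> top_cell ` {..<h}" if "c \<in> t" "t \<in> D - ?new" for c t
      proof
        assume "c \<in> top_cell ` {..<h}"
        then obtain i where i: "i < h" "c = top_cell i" by blast
        then have "t = {top_cell i}" using eq[of t "{top_cell i}" c] top[OF i(1)] that by blast
        then show False using that(2) i(1) by blast
      qed
      then show ?thesis by blast
    qed
    also have "\<dots> = ?E (below mu') - below lam"
    proof -
      have "?E (below mu') \<inter> top_cell ` {..<h} = {}"
        using top_cell_not_expanded[of _ h] unfolding s_def by blast
      then show ?thesis unfolding T(3) below_mu_grow[of h] s_def[symmetric] by blast
    qed
    also have "\<dots> = ?E (below mu' - below lam')" unfolding E[symmetric] by (simp only: vimage_Diff)
    finally show "\<Union>D' = below mu' - below lam'" unfolding expand_eq_iff .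
  next
    fix t assume "t \<in> D'"
    then have t: "?E t \<in> D" by (simp add: D'_def)
    from bspec[OF C t] show "translate (1, - 1) t \<subseteq> below lam' \<or>
        (\<exists>t'\<in>D'. t' \<noteq> t \<and> translate (1, - 1) t \<subseteq> t')"
    proof (elim disjE bexE conjE)
      assume "translate (1, - 1) (?E t) \<subseteq> below lam"
      then show ?thesis unfolding E[symmetric] expand_translate[symmetric] expand_subset_iff ..
    next
      fix t' assume 2: "t' \<in> D" "t' \<noteq> ?E t" "translate (1, - 1) (?E t) \<subseteq> t'"
      have "?E t \<noteq> {}" using dyck_tile_nonempty T(1) t by blast
      then obtain c where "c \<in> ?E t" by blast
      moreover obtain x y where "c = (x, y)" by (cases c)
      ultimately have xy: "(x, y) \<in> ?E t" by (simp only:)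
      then have "(x + 1, y - 1) \<in> translate (1, - 1) (?E t)" by (simp add: mem_translate)
      then have "(x + 1, y - 1) \<in> t'" using 2(3) by blast
      moreover have "y \<le> int n" using row xy t by blast
      ultimately have "t' \<notin> ?new" by (auto simp: top_cell_def)
      then have "t' \<in> ?E ` D'" unfolding D' using 2(1) by (intro DiffI)
      then obtain t0 where t0: "t' = ?E t0" "t0 \<in> D'" by (rule imageE)
      have "t0 \<noteq> t \<and> translate (1, - 1) t \<subseteq> t0"
        using 2(2,3) unfolding t0(1) expand_translate[symmetric] expand_subset_iff expand_eq_iff by (rule conjI)
      then show ?thesis using t0(2) by blast
    qed
  qed
  ultimately show ?thesis using h lam' above' unfolding dyck_tilings_def by blast
qed

section \<open>The generating function\<close>

lemma sum_tilings_grow: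
  fixes q :: "'a::comm_semiring_1"
  shows "(\<Sum>D\<in>dyck_tilings k (Suc n) mu. q ^ card D) =
    q_bracket (Suc (j - k)) q * (\<Sum>D\<in>dyck_tilings k n mu'. q ^ card D)"
proof -
  let ?A = "{..<Suc (j - k)} \<times> dyck_tilings k n mu'"
  have inj: "inj_on (\<lambda>(h, D). grow h D) ?A"
  proof (rule inj_onI)
    fix a b assume ab: "a \<in> ?A" "b \<in> ?A"
      "(case a of (h, D) \<Rightarrow> grow h D) = (case b of (h, D) \<Rightarrow> grow h D)"
    obtain h D h' D' where "a = (h, D)" "b = (h', D')" by (cases a, cases b)
    then show "a = b" using ab grow_inj[of D D' h h'] by simp
  qed
  have image: "(\<lambda>(h, D). grow h D) ` ?A = dyck_tilings k (Suc n) mu"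
  proof
    show "(\<lambda>(h, D). grow h D) ` ?A \<subseteq> dyck_tilings k (Suc n) mu"
      using grow_tiling by auto
    show "dyck_tilings k (Suc n) mu \<subseteq> (\<lambda>(h, D). grow h D) ` ?A"
    proof
      fix D assume "D \<in> dyck_tilings k (Suc n) mu"
      then obtain h D' where "h \<le> j - k" "D' \<in> dyck_tilings k n mu'" "D = grow h D'"
        using grow_surj by blast
      then show "D \<in> (\<lambda>(h, D). grow h D) ` ?A"
        by (intro image_eqI[of _ _ "(h, D')"]) auto
    qed
  qed
  have "(\<Sum>D\<in>dyck_tilings k (Suc n) mu. q ^ card D) = (\<Sum>(h, D)\<in>?A. q ^ card (grow h D))"
    unfolding image[symmetric] sum.reindex[OF inj] by (simp add: case_prod_unfold comp_def)
  also have "\<dots> = (\<Sum>(h, D)\<in>?A. q ^ h * q ^ card D)"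
    by (intro sum.cong refl) (auto simp: card_grow power_add)
  also have "\<dots> = q_bracket (Suc (j - k)) q * (\<Sum>D\<in>dyck_tilings k n mu'. q ^ card D)"
    by (simp only: q_bracket_def sum_product sum.cartesian_product)
  finally show ?thesis .
qed

lemma height_last_up: "height k (int m - int n, int n) = Suc (j - k)"
proof -
  have 1: "int k * int n - (int m - int n) = int (j - k)"
    using length_mu' by (simp add: algebra_simps flip: of_nat_mult of_nat_add)
  then have "int m - int n \<le> int k * int n" by linarith
  from height_eq[OF this] 1 show ?thesis by linarith
qed

end

lemma point_append: "i \<le> length p \<Longrightarrow> point (p @ p') i = point p i"
  by (simp add: point_def)

lemma up_steps_append_downs: "up_steps (p @ replicate d Down) = up_steps p"
proof -
  have "i < length (p @ replicate d Down) \<and> (p @ replicate d Down) ! i = Up \<longleftrightarrow>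
      i < length p \<and> p ! i = Up" for i
    by (auto simp: nth_append)
  then have "up_steps (p @ replicate d Down) =
      {point (p @ replicate d Down) i | i. i < length p \<and> p ! i = Up}"
    unfolding up_steps_def by simp
  also have "\<dots> = up_steps p"
    unfolding up_steps_def by (intro Collect_cong ex_cong1) (auto simp: point_append)
  finally show ?thesis .
qed

lemma up_steps_append_Up_downs:
  "up_steps (p @ Up # replicate d Down) = insert (point p (length p)) (up_steps p)"
proof -
  have "i < length (p @ Up # replicate d Down) \<and> (p @ Up # replicate d Down) ! i = Up \<longleftrightarrow>
      i = length p \<or> i < length p \<and> p ! i = Up" for i
    by (auto simp: nth_append nth_Cons split: nat.splits)
  then have "up_steps (p @ Up # replicate d Down) =
      {point (p @ Up # replicate d Down) i | i. i = length p \<or> i < length p \<and> p ! i = Up}"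
    unfolding up_steps_def by simp
  also have "\<dots> = {point p i | i. i = length p \<or> i < length p \<and> p ! i = Up}"
    by (intro Collect_cong ex_cong1) (auto simp: point_append)
  also have "\<dots> = insert (point p (length p)) (up_steps p)"
    by (auto simp: up_steps_def)
  finally show ?thesis .
qed

lemma finite_up_steps: "finite (up_steps p)"
proof -
  have "up_steps p \<subseteq> point p ` {..<length p}" by (auto simp: up_steps_def)
  then show ?thesis by (rule finite_subset) simp
qed

lemma split_last_up_step:
  assumes "dyck_path k (Suc n) \<mu>"
  obtains p j where "\<mu> = p @ Up # replicate j Down"
proof -
  have "count_list \<mu> Up = Suc n" using assms by (simp add: dyck_path_ups ups_def)
  then have "Up \<in> set \<mu>" by (metis count_notin nat.distinct(1))
  then obtain p r where pr: "\<mu> = p @ Up # r" "Up \<notin> set r"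
    by (meson split_list_last)
  have "s = Down" if "s \<in> set r" for s using pr(2) that by (cases s) auto
  then have "r = replicate (length r) Down" by (simp add: replicate_eqI)
  then show ?thesis using that pr(1) by metis
qed

lemma dyck_tilings_0: "dyck_tilings k 0 [] = {{}}"
proof -
  have "D \<in> dyck_tilings k 0 [] \<longleftrightarrow> D = {}" for D
  proof
    assume "D \<in> dyck_tilings k 0 []"
    then obtain lam where lam: "dyck_path k 0 lam" "dyck_tiling k lam [] D"
      by (auto simp: dyck_tilings_def)
    then have "lam = []" by (simp add: dyck_path_ups)
    then have "\<Union>D = {}" and "\<forall>t\<in>D. dyck_tile k t"
      using lam(2) by (auto simp: dyck_tiling_def region_def cell_above_path_def up_steps_def)
    then show "D = {}" using dyck_tile_nonempty by blast
  next
    assume "D = {}"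
    moreover have "region [] [] = {}"
      by (auto simp: region_def cell_above_path_def up_steps_def)
    moreover have "dyck_path k 0 []" "path_weakly_above [] []"
      by (auto simp: dyck_path_ups path_weakly_above_ups)
    ultimately show "D \<in> dyck_tilings k 0 []"
      by (auto simp: dyck_tilings_def dyck_tiling_def cover_inclusive_def intro!: exI[of _ "[]"])
  qed
  then show ?thesis by blast
qed

theorem theorem3p2:
  fixes k n :: nat and \<mu> :: path and q :: "'a::comm_semiring_1"
  assumes "k \<ge> 1" and "n \<ge> 1" and "dyck_path k n \<mu>"
  shows "(\<Sum>D\<in>dyck_tilings k n \<mu>. q ^ tiles D) = (\<Prod>u\<in>up_steps \<mu>. q_bracket (height k u) q)"
  using assms(3)
proof (induction n arbitrary: \<mu>)
  case 0
  then have "\<mu> = []" by (simp add: dyck_path_ups)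
  then show ?case by (simp add: dyck_tilings_0 up_steps_def)
next
  case (Suc n)
  obtain p j where \<mu>: "\<mu> = p @ Up # replicate j Down"
    using split_last_up_step[OF Suc.prems] .
  interpret last_up_step k n j p
    using Suc.prems by unfold_locales (simp only: \<mu>)
  have last: "point p m = (int m - int n, int n)" by (simp add: point_ups ups_p)
  have "point p m \<notin> up_steps p"
    using up_step_left_iff(3)[of "int m - int n" "int n" p] by (auto simp: last ups_p)
  then have "(\<Prod>u\<in>up_steps mu. q_bracket (height k u) q) =
      q_bracket (Suc (j - k)) q * (\<Prod>u\<in>up_steps p. q_bracket (height k u) q)"
    by (simp add: up_steps_append_Up_downs finite_up_steps last height_last_up)
  also have "(\<Prod>u\<in>up_steps p. q_bracket (height k u) q) =
      (\<Sum>D\<in>dyck_tilings k n mu'. q ^ tiles D)"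
    using Suc.IH[OF dyck'] by (simp add: up_steps_append_downs)
  finally show ?case unfolding \<mu> sum_tilings_grow ..
qed

end
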